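(* Every strong digraph has a spanning strong $3$-partite subdigraph, and such a subdigraph can be constructed in polynomial time (that is, there is a polynomial-time algorithm which, given a strong digraph $D$, outputs a spanning strong $3$-partite subdigraph of $D$).
   Context: Digraphs are finite, without loops or parallel arcs (directed $2$-cycles are allowed). A digraph is strong (strongly connected) if for every ordered pair of vertices $u,v$ there is a directed path from $u$ to $v$. A subdigraph is spanning if it contains all vertices. A digraph is $k$-partite if its vertex set can be partitioned into $k$ (possibly empty) sets each of which induces no arc. *)

theory Defs
  imports "Graph_Theory.Graph_Theory" "HOL-Computational_Algebra.Polynomial"
begin

definition k_partite :: "nat \<Rightarrow> ('a, 'b) pre_digraph \<Rightarrow> bool" where
  "k_partite k G \<longleftrightarrow> (\<exists>P :: nat \<Rightarrow> 'a set.
     (\<Union>i<k. P i) = verts G \<and> disjoint_family_on P {..<k} \<and>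
     (\<forall>i<k. arcs (G \<restriction> P i) = {}))"

text \<open>
  Polynomial time is measured on a random access machine: a state consists of registers,
  which are addressed directly by the program, and an unbounded memory, which is addressed
  indirectly through registers. Programs are structured (sequence, branch, loop), and every
  elementary instruction and every test costs one step. The only arithmetic is addition and
  truncated subtraction, so each step lengthens the largest number present by at most one bit
  (beyond the constants in the program); hence unit cost is polynomially equivalent to
  logarithmic cost and to Turing machine time.
\<close>

type_synonym ram_state = "(nat \<Rightarrow> nat) \<times> (nat \<Rightarrow> nat)"

datatype ram_prog =
    Skip
  | Set_Const nat nat
  | Plus nat nat nat
  | Minus nat nat nat
  | Load nat nat
  | Store nat nat
  | Seq ram_prog ram_prog
  | If_Nonzero nat ram_prog ram_prog
  | While_Nonzero nat ram_prog

text \<open>\<open>ram_exec c s t s'\<close>: program \<open>c\<close> started in \<open>s\<close> halts after \<open>t\<close> steps in \<open>s'\<close>.\<close>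

inductive ram_exec :: "ram_prog \<Rightarrow> ram_state \<Rightarrow> nat \<Rightarrow> ram_state \<Rightarrow> bool" where
  Skip: "ram_exec Skip s 1 s"
| Set_Const: "ram_exec (Set_Const x k) (r, m) 1 (r(x := k), m)"
| Plus: "ram_exec (Plus x y z) (r, m) 1 (r(x := r y + r z), m)"
| Minus: "ram_exec (Minus x y z) (r, m) 1 (r(x := r y - r z), m)"
| Load: "ram_exec (Load x y) (r, m) 1 (r(x := m (r y)), m)"
| Store: "ram_exec (Store x y) (r, m) 1 (r, m(r x := r y))"
| Seq: "ram_exec c1 s1 t1 s2 \<Longrightarrow> ram_exec c2 s2 t2 s3 \<Longrightarrow>
    ram_exec (Seq c1 c2) s1 (t1 + t2) s3"
| If_True: "fst s x \<noteq> 0 \<Longrightarrow> ram_exec c1 s t s' \<Longrightarrow>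
    ram_exec (If_Nonzero x c1 c2) s (Suc t) s'"
| If_False: "fst s x = 0 \<Longrightarrow> ram_exec c2 s t s' \<Longrightarrow>
    ram_exec (If_Nonzero x c1 c2) s (Suc t) s'"
| While_False: "fst s x = 0 \<Longrightarrow> ram_exec (While_Nonzero x c) s 1 s"
| While_True: "fst s1 x \<noteq> 0 \<Longrightarrow> ram_exec c s1 t1 s2 \<Longrightarrow>
    ram_exec (While_Nonzero x c) s2 t2 s3 \<Longrightarrow>
    ram_exec (While_Nonzero x c) s1 (Suc (t1 + t2)) s3"

inductive_cases ram_exec_elims:
  "ram_exec Skip s t s'" "ram_exec (Set_Const x k) s t s'" "ram_exec (Plus x y z) s t s'"
  "ram_exec (Minus x y z) s t s'" "ram_exec (Load x y) s t s'" "ram_exec (Store x y) s t s'"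
  "ram_exec (Seq c1 c2) s t s'" "ram_exec (If_Nonzero x c1 c2) s t s'"
  "ram_exec (While_Nonzero x c) s t s'"

lemma ram_exec_deterministic:
  "ram_exec c s t s' \<Longrightarrow> ram_exec c s u s'' \<Longrightarrow> u = t \<and> s'' = s'"
proof (induction arbitrary: u s'' rule: ram_exec.induct)
  case (Seq c1 s1 t1 s2 c2 t2 s3)
  from Seq.prems obtain v1 v2 s where
    "u = v1 + v2" "ram_exec c1 s1 v1 s" "ram_exec c2 s v2 s''"
    by (rule ram_exec_elims(7))
  with Seq.IH show ?case by metis
next
  case (If_True s x c1 t s' c2)
  from If_True.prems If_True.hyps(1) obtain v where "u = Suc v" "ram_exec c1 s v s''"
    by - (erule ram_exec_elims(8), simp_all)
  with If_True.IH show ?case by metis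
next
  case (If_False s x c2 t s' c1)
  from If_False.prems If_False.hyps(1) obtain v where "u = Suc v" "ram_exec c2 s v s''"
    by - (erule ram_exec_elims(8), simp_all)
  with If_False.IH show ?case by metis
next
  case (While_False s x c)
  from While_False.prems While_False.hyps show ?case
    by - (erule ram_exec_elims(9), simp_all)
next
  case (While_True s1 x c t1 s2 t2 s3)
  from While_True.prems While_True.hyps(1) obtain v1 v2 s where
    "u = Suc (v1 + v2)" "ram_exec c s1 v1 s" "ram_exec (While_Nonzero x c) s v2 s''"
    by - (erule ram_exec_elims(9), simp_all)
  with While_True.IH show ?case by metis
qed (erule ram_exec_elims(1-6), simp)+

text \<open>
  A digraph on the vertices \<open>0, \<dots>, n - 1\<close> is represented by \<open>n\<close> in register 0 and its
  adjacency matrix, row by row, in the memory cells \<open>0, \<dots>, n\<^sup>2 - 1\<close>. In an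
  input state everything else is zero.
\<close>

definition input_state :: "nat pair_pre_digraph \<Rightarrow> ram_state" where
  "input_state D = (let n = card (pverts D) in
     ((\<lambda>_. 0)(0 := n),
      (\<lambda>a. if a < n * n \<and> (a div n, a mod n) \<in> parcs D then 1 else 0)))"

definition output_digraph :: "ram_state \<Rightarrow> nat pair_pre_digraph" where
  "output_digraph s = (case s of (r, m) \<Rightarrow> let n = r 0 in
     \<lparr> pverts = {..<n},
       parcs = {(u, v). u < n \<and> v < n \<and> m (u * n + v) \<noteq> 0} \<rparr>)"

text \<open>
  \<open>polytime_constructible P R\<close>: some program, given any digraph \<open>D\<close> on
  \<open>0, \<dots>, n - 1\<close> satisfying \<open>P\<close>, outputs
  a digraph \<open>H\<close> with \<open>R D H\<close>, in time polynomial in the number of vertices; equivalently,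
  because of the matrix representation, in time polynomial in the length of the input.
\<close>

definition polytime_constructible ::
  "(nat pair_pre_digraph \<Rightarrow> bool) \<Rightarrow>
   (nat pair_pre_digraph \<Rightarrow> nat pair_pre_digraph \<Rightarrow> bool) \<Rightarrow> bool" where
  "polytime_constructible P R \<longleftrightarrow> (\<exists>(c :: ram_prog) (p :: nat poly).
     \<forall>n D. pair_digraph D \<and> pverts D = {..<n} \<and> P D \<longrightarrow>
       (\<exists>t s. ram_exec c (input_state D) t s \<and> t \<le> poly p n \<and> R D (output_digraph s)))"

end

theory Submission
  imports Defs
begin

text \<open>
  Grow a strong subdigraph by ears, each starting and ending in the part already built and having
  at least one new inner vertex. The inner vertices of an ear have in- and out-degree one, so three
  colours suffice to make every arc used bichromatic; the bichromatic arcs then form a spanning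
  strong 3-partite subdigraph.

  The algorithm never computes ears or colours. It deletes arcs greedily as long as the digraph
  stays strong. In the arc-minimal strong digraph that remains, the colouring above can leave no
  monochromatic arc, as the bichromatic arcs alone are already strong; hence it is 3-partite.
\<close>

section \<open>Colouring along ears\<close>

text \<open>Walks of \<open>E\<close> may leave \<open>V\<close>; where they must not,
  \<open>E\<close> itself is cut down to \<open>S \<times> S\<close>. Thus the strength of a part
  can be stated with the arcs of a larger set.\<close>

definition strong_on :: "'a set \<Rightarrow> 'a rel \<Rightarrow> bool" where
  "strong_on V E \<longleftrightarrow> (\<forall>x\<in>V. \<forall>y\<in>V. (x, y) \<in> E\<^sup>*)"

lemma strong_on_mono: "strong_on V E \<Longrightarrow> E \<subseteq> F \<Longrightarrow> strong_on V F"
  unfolding strong_on_def by (meson rtrancl_mono subsetD)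

definition bichromatic :: "('a \<Rightarrow> 'c) \<Rightarrow> 'a rel \<Rightarrow> 'a rel" where
  "bichromatic c E = {(x, y) \<in> E. c x \<noteq> c y}"

lemma third_colour: "\<exists>k<3. k \<noteq> (i::nat) \<and> k \<noteq> j"
proof -
  have "\<not> {0, 1, 2::nat} \<subseteq> {i, j}"
  proof
    assume "{0, 1, 2::nat} \<subseteq> {i, j}"
    then have "card {0, 1, 2::nat} \<le> card {i, j}" by (intro card_mono) auto
    also have "\<dots> \<le> 2" by (simp add: card_insert_if)
    finally show False by simp
  qed
  then show ?thesis by (auto intro: exI[of _ 0] exI[of _ 1] exI[of _ 2])
qed

text \<open>Greedy colouring from the \<open>u\<close> end: every vertex avoids its predecessor and
  also \<open>c s\<close>, so whichever is last fits \<open>s\<close>. The final hypothesis admits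
  \<open>u = s\<close> for nonempty \<open>ws\<close>; in the recursion its first alternative holds
  because \<open>k\<close> avoids \<open>c s\<close>.\<close>

lemma colour_path:
  assumes "distinct ws" "u \<notin> set ws" "s \<notin> set ws" "\<forall>x. c x < (3::nat)" "c u \<noteq> c s \<or> ws \<noteq> []"
  shows "\<exists>c'. (\<forall>x. c' x < (3::nat)) \<and> (\<forall>x. x \<notin> set ws \<longrightarrow> c' x = c x) \<and>
           successively (\<lambda>x y. c' x \<noteq> c' y) (u # ws @ [s])"
  using assms
proof (induction ws arbitrary: u c)
  case Nil
  then show ?case by (intro exI[of _ c]) auto
next
  case (Cons w ws)
  obtain k where k: "k < 3" "k \<noteq> c u" "k \<noteq> c s"
    using third_colour by blast
  have "\<exists>c'. (\<forall>x. c' x < (3::nat)) \<and> (\<forall>x. x \<notin> set ws \<longrightarrow> c' x = (c(w := k)) x) \<and>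
      successively (\<lambda>x y. c' x \<noteq> c' y) (w # ws @ [s])"
    using Cons.prems k by (intro Cons.IH) auto
  then obtain c' where c': "\<forall>x. c' x < (3::nat)" "\<forall>x. x \<notin> set ws \<longrightarrow> c' x = (c(w := k)) x"
      "successively (\<lambda>x y. c' x \<noteq> c' y) (w # ws @ [s])"
    by blast
  have "c' u \<noteq> c' w"
    using Cons.prems k c'(2) by auto
  with c' show ?case
    by (intro exI[of _ c']) auto
qed

text \<open>Stop at the first vertex in \<open>S\<close> and cut out cycles; distinctness is what
  lets \<open>colour_path\<close> colour each inner vertex once.\<close>

lemma first_return_path:
  assumes "(w, s) \<in> E\<^sup>*" "w \<notin> S" "s \<in> S"
  shows "\<exists>ws t. distinct (w # ws) \<and> set (w # ws) \<inter> S = {} \<and> t \<in> S \<and>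
           successively (\<lambda>x y. (x, y) \<in> E) (w # ws @ [t])"
  using assms
proof (induction rule: converse_rtrancl_induct)
  case base
  then show ?case by simp
next
  case (step w w')
  show ?case
  proof (cases "w' \<in> S")
    case True
    with step show ?thesis by (intro exI[of _ "[]"] exI[of _ w']) auto
  next
    case False
    then obtain ws t where ws: "distinct (w' # ws)" "set (w' # ws) \<inter> S = {}" "t \<in> S"
        "successively (\<lambda>x y. (x, y) \<in> E) (w' # ws @ [t])"
      using step by blast
    show ?thesis
    proof (cases "w \<in> set (w' # ws)")
      case True
      \<comment> \<open>Since \<open>w\<close> recurs, the part of the path from that occurrence on
        already starts at \<open>w\<close>.\<close>
      then obtain xs ys where xy: "w' # ws = xs @ w # ys"
        by (meson split_list)
      then have "w' # ws @ [t] = xs @ (w # ys @ [t])" by simp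
      with ws(4) have "successively (\<lambda>x y. (x, y) \<in> E) (w # ys @ [t])"
        by (metis successively_append_iff)
      moreover have "distinct (w # ys)" "set (w # ys) \<inter> S = {}"
        using ws(1,2) unfolding xy by auto
      ultimately show ?thesis using ws(3) by blast
    next
      case False
      with ws step(1) \<open>w \<notin> S\<close> show ?thesis
        by (intro exI[of _ "w' # ws"] exI[of _ t]) auto
    qed
  qed
qed

lemma successively_restrict:
  assumes "successively (\<lambda>x y. (x, y) \<in> E) xs" "successively (\<lambda>x y. c x \<noteq> c y) xs" "set xs \<subseteq> S"
  shows "successively (\<lambda>x y. (x, y) \<in> bichromatic c (E \<inter> S \<times> S)) xs"
  using assms by (induction xs rule: induct_list012) (auto simp: bichromatic_def)

lemma successively_rtrancl_from:
  assumes "successively (\<lambda>x y. (x, y) \<in> R) (u # ws)" "x \<in> set ws"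
  shows "(u, x) \<in> R\<^sup>*"
  using assms by (induction ws arbitrary: u) (auto intro: converse_rtrancl_into_rtrancl)

lemma successively_rtrancl_to:
  assumes "successively (\<lambda>x y. (x, y) \<in> R) (ws @ [t])" "x \<in> set ws"
  shows "(x, t) \<in> R\<^sup>*"
  using successively_rtrancl_from[of "R\<inverse>" t "rev ws" x] assms successively_rev[of _ "ws @ [t]"]
  by (simp add: rtrancl_converse)

text \<open>\<open>u\<close> serves as a hub: the ear leads from \<open>u\<close> to each inner
  vertex and on to \<open>t\<close>, and the old part leads from \<open>t\<close> back to
  \<open>u\<close>.\<close>

lemma strong_on_add_ear:
  assumes "strong_on S R" "u \<in> S" "t \<in> S" "successively (\<lambda>x y. (x, y) \<in> R) (u # ws @ [t])"
  shows "strong_on (S \<union> set ws) R"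
proof -
  have "(u, x) \<in> R\<^sup>* \<and> (x, u) \<in> R\<^sup>*" if "x \<in> S \<union> set ws" for x
  proof (cases "x \<in> S")
    case False
    with that have "x \<in> set ws" by simp
    then have "(u, x) \<in> R\<^sup>*" "(x, t) \<in> R\<^sup>*"
      using assms(4) successively_rtrancl_from[of R u "ws @ [t]" x]
        successively_rtrancl_to[of R "u # ws" t x] by auto
    moreover have "(t, u) \<in> R\<^sup>*" using assms(1-3) unfolding strong_on_def by auto
    ultimately show ?thesis by (meson rtrancl_trans)
  qed (use assms(1,2) in \<open>auto simp: strong_on_def\<close>)
  then show ?thesis
    unfolding strong_on_def by (meson rtrancl_trans)
qed

text \<open>
  The ear is coloured after all of \<open>S\<close>, so its inner vertices only have to avoid their
  neighbours on the ear: at most two colours each.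
\<close>

lemma extend_colouring:
  assumes E: "strong_on V E" "E \<subseteq> V \<times> V"
    and S: "S \<subseteq> V" "S \<noteq> V" "S \<noteq> {}" "\<forall>x. c x < (3::nat)"
      "strong_on S (bichromatic c (E \<inter> S \<times> S))"
  shows "\<exists>S' c'. S \<subset> S' \<and> S' \<subseteq> V \<and> (\<forall>x. c' x < (3::nat)) \<and>
           strong_on S' (bichromatic c' (E \<inter> S' \<times> S'))"
proof -
  obtain s z where "s \<in> S" "z \<in> V - S" using S by auto
  have "(s, z) \<in> E\<^sup>*" using \<open>s \<in> S\<close> \<open>z \<in> V - S\<close> S(1) E(1) unfolding strong_on_def by auto
  \<comment> \<open>A walk from inside \<open>S\<close> to outside uses an arc leaving
    \<open>S\<close>; that arc begins the ear.\<close>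
  then have "z \<in> S \<or> (\<exists>u w. u \<in> S \<and> w \<notin> S \<and> (u, w) \<in> E)"
    using \<open>s \<in> S\<close> by (induction rule: rtrancl_induct) auto
  then obtain u w where uw: "u \<in> S" "w \<notin> S" "(u, w) \<in> E" using \<open>z \<in> V - S\<close> by auto
  with E S(1) have "(w, u) \<in> E\<^sup>*" unfolding strong_on_def by auto
  from first_return_path[OF this uw(2,1)] obtain ws t where
    ws: "distinct (w # ws)" "set (w # ws) \<inter> S = {}" "t \<in> S"
      "successively (\<lambda>x y. (x, y) \<in> E) (w # ws @ [t])"
    by blast
  \<comment> \<open>The ear may return to its start, \<open>u = t\<close>; its inner vertex
    \<open>w\<close> is what \<open>colour_path\<close> asks for in that case.\<close>
  have "\<exists>c'. (\<forall>x. c' x < (3::nat)) \<and> (\<forall>x. x \<notin> set (w # ws) \<longrightarrow> c' x = c x) \<and>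
      successively (\<lambda>x y. c' x \<noteq> c' y) (u # (w # ws) @ [t])"
    using ws uw S by (intro colour_path) auto
  then obtain c' where c': "\<forall>x. c' x < (3::nat)" "\<forall>x. x \<notin> set (w # ws) \<longrightarrow> c' x = c x"
      "successively (\<lambda>x y. c' x \<noteq> c' y) (u # (w # ws) @ [t])"
    by blast
  let ?S = "S \<union> set (w # ws)"
  let ?R = "bichromatic c' (E \<inter> ?S \<times> ?S)"
  have ear: "successively (\<lambda>x y. (x, y) \<in> E) (u # (w # ws) @ [t])"
    using ws(4) uw(3) by simp
  have "successively (\<lambda>x y. (x, y) \<in> ?R) (u # (w # ws) @ [t])"
    using ear c'(3) uw(1) ws(3) by (intro successively_restrict) auto
  moreover have "bichromatic c (E \<inter> S \<times> S) \<subseteq> ?R"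
  proof -
    have "c' x = c x" if "x \<in> S" for x using that c'(2) ws(2) by blast
    then show ?thesis by (auto simp: bichromatic_def)
  qed
  ultimately have "strong_on ?S ?R"
    using strong_on_add_ear strong_on_mono[OF S(5)] uw(1) ws(3) by metis
  moreover have "set (w # ws) \<subseteq> V"
  proof
    fix x assume "x \<in> set (w # ws)"
    then have "(u, x) \<in> E\<^sup>*" using successively_rtrancl_from[OF ear] by auto
    then show "x \<in> V" using uw(1) S(1) E(2) by (induction rule: rtrancl_induct) auto
  qed
  ultimately show ?thesis
    using c'(1) S(1) uw(2) by (intro exI[of _ ?S] exI[of _ c']) auto
qed

text \<open>A single vertex is strong by reflexivity; each ear then lowers the number of missing
  vertices.\<close>

lemma three_colouring:
  assumes "finite V" "strong_on V E" "E \<subseteq> V \<times> V"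
  shows "\<exists>c :: 'a \<Rightarrow> nat. (\<forall>x. c x < 3) \<and> strong_on V (bichromatic c E)"
proof (cases "V = {}")
  case True
  then show ?thesis unfolding strong_on_def by (auto intro: exI[of _ "\<lambda>_. 0"])
next
  case False
  then obtain v where "v \<in> V" by auto
  have "\<exists>c :: 'a \<Rightarrow> nat. (\<forall>x. c x < 3) \<and> strong_on V (bichromatic c E)"
    if "S \<subseteq> V" "S \<noteq> {}" "\<forall>x. c x < (3::nat)" "strong_on S (bichromatic c (E \<inter> S \<times> S))"
    for S and c :: "'a \<Rightarrow> nat"
    using that
  proof (induction "card (V - S)" arbitrary: S c rule: less_induct)
    case less
    show ?case
    proof (cases "S = V")
      case True
      then show ?thesis using less.prems assms(3) by (auto simp: Int_absorb2)
    next
      case False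
      then obtain S' c' where S': "S \<subset> S'" "S' \<subseteq> V" "\<forall>x. c' x < (3::nat)"
          "strong_on S' (bichromatic c' (E \<inter> S' \<times> S'))"
        using extend_colouring[OF assms(2,3) less.prems(1) _ less.prems(2-4)] by blast
      then have "card (V - S') < card (V - S)"
        using \<open>finite V\<close> by (intro psubset_card_mono) auto
      with S' show ?thesis using less.hyps by blast
    qed
  qed
  from this[of "{v}" "\<lambda>_. 0"] \<open>v \<in> V\<close> show ?thesis by (simp add: strong_on_def)
qed

section \<open>Translation to digraphs\<close>

text \<open>Reachability in a digraph is reflexive on vertices only, \<open>rtrancl\<close>
  everywhere; hence the assumption on \<open>u\<close>.\<close>

lemma (in wf_digraph) reachable_iff_rtrancl:
  assumes "u \<in> verts G"
  shows "u \<rightarrow>\<^sup>* v \<longleftrightarrow> (u, v) \<in> (arcs_ends G)\<^sup>*"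
proof
  assume "(u, v) \<in> (arcs_ends G)\<^sup>*"
  then show "u \<rightarrow>\<^sup>* v"
    using assms by (induction rule: rtrancl_induct) (auto intro: reachable_adj_trans)
qed (auto simp: reachable_def intro: rtrancl_on_rtranclI)

lemma (in wf_digraph) strongly_connected_iff_strong_on:
  "strongly_connected G \<longleftrightarrow> verts G \<noteq> {} \<and> strong_on (verts G) (arcs_ends G)"
  unfolding strongly_connected_def strong_on_def by (auto simp: reachable_iff_rtrancl)

lemma k_partiteI:
  assumes "\<And>v. v \<in> verts G \<Longrightarrow> c v < k" "\<And>e. e \<in> arcs G \<Longrightarrow> c (tail G e) \<noteq> c (head G e)"
  shows "k_partite k G"
  unfolding k_partite_def using assms
  by (intro exI[of _ "\<lambda>i. {v \<in> verts G. c v = i}"])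
     (fastforce simp: induce_subgraph_def disjoint_family_on_def)

lemma (in digraph) spanning_strong_3_partite:
  assumes "strongly_connected G"
  shows "\<exists>H. spanning H G \<and> strongly_connected H \<and> k_partite 3 H"
proof -
  have G: "verts G \<noteq> {}" "strong_on (verts G) (arcs_ends G)"
    using assms by (auto simp: strongly_connected_iff_strong_on)
  have "arcs_ends G \<subseteq> verts G \<times> verts G" by (auto simp: arcs_ends_conv)
  from three_colouring[OF finite_verts G(2) this] obtain c :: "'a \<Rightarrow> nat" where
    c: "\<forall>x. c x < 3" "strong_on (verts G) (bichromatic c (arcs_ends G))"
    by blast
  \<comment> \<open>Only monochromatic arcs are dropped, so the colour classes of \<open>c\<close>
    are independent in \<open>H\<close>.\<close>
  define H where "H = G\<lparr>arcs := {e \<in> arcs G. c (tail G e) \<noteq> c (head G e)}\<rparr>"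
  interpret H: wf_digraph H by unfold_locales (auto simp: H_def)
  have "arcs_ends H = bichromatic c (arcs_ends G)"
    by (auto simp: H_def bichromatic_def arcs_ends_conv)
  then have "strongly_connected H"
    using G c by (simp add: H.strongly_connected_iff_strong_on) (simp add: H_def)
  moreover have "spanning H G"
    using wf_digraph H.wf_digraph
    by (auto simp: spanning_def subgraph_def compatible_def H_def)
  moreover have "k_partite 3 H"
    using c by (intro k_partiteI[of _ c]) (auto simp: H_def)
  ultimately show ?thesis by blast
qed

text \<open>Deleting an arc keeps a digraph strong exactly if the head stays reachable from the
  tail, so a single search per arc decides whether it can go.\<close>

definition minimally_strong_on :: "'a set \<Rightarrow> 'a rel \<Rightarrow> bool" where
  "minimally_strong_on V E \<longleftrightarrow>
     strong_on V E \<and> (\<forall>(x, y)\<in>E. (x, y) \<notin> (E - {(x, y)})\<^sup>*)"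

lemma minimally_strong_3_partite:
  assumes "finite V" "minimally_strong_on V E" "E \<subseteq> V \<times> V"
  shows "k_partite 3 (with_proj \<lparr>pverts = V, parcs = E\<rparr>)"
proof -
  obtain c :: "'a \<Rightarrow> nat" where c: "\<forall>x. c x < 3" "strong_on V (bichromatic c E)"
    using three_colouring assms unfolding minimally_strong_on_def by blast
  have "c x \<noteq> c y" if "(x, y) \<in> E" for x y
  proof
    \<comment> \<open>The bichromatic walk from \<open>x\<close> to \<open>y\<close> avoids this arc
      and would bypass it, against minimality.\<close>
    assume "c x = c y"
    then have "bichromatic c E \<subseteq> E - {(x, y)}" by (auto simp: bichromatic_def)
    then have "(bichromatic c E)\<^sup>* \<subseteq> (E - {(x, y)})\<^sup>*" by (rule rtrancl_mono)
    moreover have "(x, y) \<in> (bichromatic c E)\<^sup>*"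
      using c(2) that assms(3) unfolding strong_on_def by auto
    ultimately show False
      using assms(2) that unfolding minimally_strong_on_def by auto
  qed
  with c(1) show ?thesis by (intro k_partiteI[of _ c]) auto
qed

section \<open>Total correctness with time bounds\<close>

text \<open>Time is only bounded from above, so the budgets of program pieces combine by plain
  arithmetic.\<close>

definition runs :: "ram_prog \<Rightarrow> (nat \<Rightarrow> nat) \<Rightarrow> (nat \<Rightarrow> nat) \<Rightarrow> nat \<Rightarrow>
    ((nat \<Rightarrow> nat) \<Rightarrow> (nat \<Rightarrow> nat) \<Rightarrow> bool) \<Rightarrow> bool" where
  "runs c r m T Q \<longleftrightarrow> (\<exists>t r' m'. ram_exec c (r, m) t (r', m') \<and> t \<le> T \<and> Q r' m')"

text \<open>A syntactic frame for registers. Stores go to computed addresses, so memory is left to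
  the invariants.\<close>

fun writes :: "ram_prog \<Rightarrow> nat set" where
  "writes Skip = {}"
| "writes (Set_Const x k) = {x}"
| "writes (Plus x y z) = {x}"
| "writes (Minus x y z) = {x}"
| "writes (Load x y) = {x}"
| "writes (Store x y) = {}"
| "writes (Seq c d) = writes c \<union> writes d"
| "writes (If_Nonzero x c d) = writes c \<union> writes d"
| "writes (While_Nonzero x c) = writes c"

lemma ram_exec_writes: "ram_exec c s t s' \<Longrightarrow> q \<notin> writes c \<Longrightarrow> fst s' q = fst s q"
  by (induction rule: ram_exec.induct) auto

text \<open>Weakening may use the frame, so postconditions need not repeat untouched
  registers.\<close>

lemma runs_mono:
  assumes "runs c r m T Q" "T \<le> T'"
    and "\<And>r' m'. Q r' m' \<Longrightarrow> \<forall>q. q \<notin> writes c \<longrightarrow> r' q = r q \<Longrightarrow> Q' r' m'"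
  shows "runs c r m T' Q'"
  using assms ram_exec_writes unfolding runs_def by (metis fst_conv le_trans)

lemma runs_Skip: "Q r m \<Longrightarrow> runs Skip r m 1 Q"
  unfolding runs_def by (blast intro: ram_exec.intros)

lemma runs_Set_Const: "Q (r(x := k)) m \<Longrightarrow> runs (Set_Const x k) r m 1 Q"
  unfolding runs_def by (blast intro: ram_exec.intros)

lemma runs_Plus: "Q (r(x := r y + r z)) m \<Longrightarrow> runs (Plus x y z) r m 1 Q"
  unfolding runs_def by (blast intro: ram_exec.intros)

lemma runs_Minus: "Q (r(x := r y - r z)) m \<Longrightarrow> runs (Minus x y z) r m 1 Q"
  unfolding runs_def by (blast intro: ram_exec.intros)

lemma runs_Load: "Q (r(x := m (r y))) m \<Longrightarrow> runs (Load x y) r m 1 Q"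
  unfolding runs_def by (blast intro: ram_exec.intros)

lemma runs_Store: "Q r (m(r x := r y)) \<Longrightarrow> runs (Store x y) r m 1 Q"
  unfolding runs_def by (blast intro: ram_exec.intros)

lemma runs_Seq: "runs c r m T (\<lambda>r' m'. runs d r' m' U Q) \<Longrightarrow> runs (Seq c d) r m (T + U) Q"
  unfolding runs_def by (blast intro: ram_exec.intros add_mono)

text \<open>The branch budgets are added instead of maximised, which keeps all bounds polynomial
  expressions.\<close>

lemma runs_If_Nonzero:
  assumes "r x \<noteq> 0 \<Longrightarrow> runs c r m T Q" "r x = 0 \<Longrightarrow> runs d r m U Q"
  shows "runs (If_Nonzero x c d) r m (Suc (T + U)) Q"
proof (cases "r x = 0")
  case True
  with assms(2) obtain t r' m' where "ram_exec d (r, m) t (r', m')" "t \<le> U" "Q r' m'"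
    unfolding runs_def by blast
  with True show ?thesis
    unfolding runs_def by (intro exI[of _ "Suc t"]) (auto intro!: exI ram_exec.If_False)
next
  case False
  with assms(1) obtain t r' m' where "ram_exec c (r, m) t (r', m')" "t \<le> T" "Q r' m'"
    unfolding runs_def by blast
  with False show ?thesis
    unfolding runs_def by (intro exI[of _ "Suc t"]) (auto intro!: exI ram_exec.If_True)
qed

text \<open>The counter is both termination measure and index of the invariant. A round costs its
  body and one test; the extra 1 is the final, failing test.\<close>

lemma runs_While_Nonzero_count:
  assumes "\<And>k r m. k < n \<Longrightarrow> r x = Suc k \<Longrightarrow> I (Suc k) r m \<Longrightarrow>
      runs c r m T (\<lambda>r' m'. r' x = k \<and> I k r' m')"
    and "r x = n" "I n r m"
  shows "runs (While_Nonzero x c) r m (1 + n * Suc T) (I 0)"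
  using assms
proof (induction n arbitrary: r m)
  case 0
  then show ?case unfolding runs_def using ram_exec.While_False[of "(r, m)" x c] by fastforce
next
  case (Suc n)
  then obtain t r' m' where c: "ram_exec c (r, m) t (r', m')" "t \<le> T" "r' x = n" "I n r' m'"
    unfolding runs_def by blast
  from Suc.IH[of r' m'] Suc.prems(1) c(3,4) obtain u r'' m'' where
    d: "ram_exec (While_Nonzero x c) (r', m') u (r'', m'')" "u \<le> 1 + n * Suc T" "I 0 r'' m''"
    unfolding runs_def by (metis less_Suc_eq)
  have "ram_exec (While_Nonzero x c) (r, m) (Suc (t + u)) (r'', m'')"
    using ram_exec.While_True[OF _ c(1) d(1)] Suc.prems(2) by simp
  moreover have "Suc (t + u) \<le> 1 + Suc n * Suc T" using c(2) d(2) by simp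
  ultimately show ?case using d(3) unfolding runs_def by blast
qed

text \<open>
  Conventions for the rest: register 0 holds \<open>n\<close>, register 1 holds 1, register 2 holds 0 and
  register 3 holds \<open>n\<^sup>2\<close>. Loops count down, so that the counter read in the body of \<open>for_reg\<close> runs
  through \<open>n - 1, \<dots>, 0\<close>; \<open>for_cells\<close> runs through all matrix cells \<open>(i, j)\<close> with their address
  \<open>i * n + j\<close> in register \<open>a\<close>, in decreasing order of address.
\<close>

definition for_reg :: "nat \<Rightarrow> ram_prog \<Rightarrow> ram_prog" where
  "for_reg i c = Seq (Plus i 0 2) (While_Nonzero i (Seq (Minus i i 1) c))"

definition for_cells :: "nat \<Rightarrow> nat \<Rightarrow> nat \<Rightarrow> ram_prog \<Rightarrow> ram_prog" where
  "for_cells i j a c = Seq (Plus a 3 2) (for_reg i (for_reg j (Seq (Minus a a 1) c)))"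

lemma writes_for_reg [simp]: "writes (for_reg i c) = insert i (writes c)"
  by (auto simp: for_reg_def)

lemma writes_for_cells [simp]: "writes (for_cells i j a c) = {i, j, a} \<union> writes c"
  by (auto simp: for_cells_def)

text \<open>The body starts with the counter already lowered to \<open>k\<close>. The 2 per round
  pays for test and decrement, the leading 2 for copying \<open>n\<close> and for the last
  test.\<close>

lemma runs_for_reg:
  assumes i: "{0, 1, 2, i} \<inter> writes c = {}" "i \<notin> {0, 1, 2}"
    and r: "r 0 = n" "r 1 = 1" "r 2 = 0"
    and I: "I n (r(i := n)) m"
    and body: "\<And>k r' m'. k < n \<Longrightarrow> \<forall>q. q \<notin> insert i (writes c) \<longrightarrow> r' q = r q \<Longrightarrow>
      r' i = Suc k \<Longrightarrow> I (Suc k) r' m' \<Longrightarrow> runs c (r'(i := k)) m' T (I k)"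
  shows "runs (for_reg i c) r m (2 + n * (2 + T)) (I 0)"
proof -
  \<comment> \<open>Carrying the frame in the invariant gives the body the initial values of the
    constant registers in every round.\<close>
  let ?J = "\<lambda>k r' m'. (\<forall>q. q \<notin> insert i (writes c) \<longrightarrow> r' q = r q) \<and> I k r' m'"
  have "runs (While_Nonzero i (Seq (Minus i i 1) c)) (r(i := n)) m (1 + n * Suc (1 + T)) (?J 0)"
  proof (rule runs_While_Nonzero_count[where I = ?J])
    fix k r' m' assume k: "k < n" "r' i = Suc k" "?J (Suc k) r' m'"
    have "r' 1 = 1" using k(3) i r by auto
    with k(2) have *: "r' i - r' 1 = k" by simp
    show "runs (Seq (Minus i i 1) c) r' m' (1 + T) (\<lambda>r' m'. r' i = k \<and> ?J k r' m')"
      apply (rule runs_Seq, rule runs_Minus)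
      apply (unfold *)
      apply (rule runs_mono[OF body[of k r' m'] order_refl])
      using k i by auto
  qed (use I in auto)
  from runs_mono[OF this, of "1 + n * Suc (1 + T)" "I 0"]
  have "runs (While_Nonzero i (Seq (Minus i i 1) c)) (r(i := n)) m (1 + n * (2 + T)) (I 0)"
    by simp
  then have "runs (for_reg i c) r m (1 + (1 + n * (2 + T))) (I 0)"
    unfolding for_reg_def using r by (intro runs_Seq runs_Plus) simp
  then show ?thesis by simp
qed

text \<open>\<open>I b\<close> is meant as: the cells from address \<open>b\<close> on are done. It
  speaks of memory alone; facts about registers come from the frame.\<close>

lemma runs_for_cells:
  assumes fresh: "{0, 1, 2, 3, i, j, a} \<inter> writes c = {}" "{i, j, a} \<inter> {0, 1, 2, 3} = {}"
      "i \<noteq> j" "i \<noteq> a" "j \<noteq> a"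
    and r: "r 0 = n" "r 1 = 1" "r 2 = 0" "r 3 = n * n"
    and I: "I (n * n) m"
    and body: "\<And>x y r' m'. x < n \<Longrightarrow> y < n \<Longrightarrow> \<forall>q. q \<notin> {i, j, a} \<union> writes c \<longrightarrow> r' q = r q \<Longrightarrow>
      r' i = x \<Longrightarrow> r' j = y \<Longrightarrow> r' a = x * n + y \<Longrightarrow> I (Suc (x * n + y)) m' \<Longrightarrow>
      runs c r' m' T (\<lambda>_. I (x * n + y))"
  shows "runs (for_cells i j a c) r m (3 + n * (4 + n * (3 + T))) (\<lambda>_. I 0)"
proof -
  \<comment> \<open>Tying the address to the index makes rows join up: row \<open>x\<close> takes it
    from \<open>Suc x * n\<close> down to \<open>x * n\<close>.\<close>
  let ?J = "\<lambda>k r' m'. r' a = k \<and> I k m'"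
  have "runs (for_reg i (for_reg j (Seq (Minus a a 1) c))) (r(a := n * n)) m
      (2 + n * (2 + (2 + n * (2 + (1 + T))))) (?J (0 * n))"
  proof (rule runs_for_reg[where I = "\<lambda>k. ?J (k * n)"])
    fix x r' m'
    assume x: "x < n" "\<forall>q. q \<notin> insert i (writes (for_reg j (Seq (Minus a a 1) c))) \<longrightarrow>
        r' q = (r(a := n * n)) q" "r' i = Suc x" "?J (Suc x * n) r' m'"
    have "runs (for_reg j (Seq (Minus a a 1) c)) (r'(i := x)) m' (2 + n * (2 + (1 + T)))
        (?J (x * n + 0))"
    proof (rule runs_for_reg[where I = "\<lambda>k. ?J (x * n + k)"])
      fix y r'' m''
      assume y: "y < n" "\<forall>q. q \<notin> insert j (writes (Seq (Minus a a 1) c)) \<longrightarrow>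
        r'' q = (r'(i := x)) q" "r'' j = Suc y" "?J (x * n + Suc y) r'' m''"
      let ?r = "r''(j := y, a := x * n + y)"
      have "r'' 1 = 1" "r'' i = x" using x y fresh r by auto
      then have *: "(r''(j := y)) a - (r''(j := y)) 1 = x * n + y"
        using y fresh by auto
      have "runs c ?r m'' T (\<lambda>_. I (x * n + y))"
        by (rule body) (use x y fresh \<open>r'' i = x\<close> in auto)
      then have "runs c ?r m'' T (?J (x * n + y))"
        by (rule runs_mono) (use fresh in auto)
      then show "runs (Seq (Minus a a 1) c) (r''(j := y)) m'' (1 + T) (?J (x * n + y))"
        using * by (intro runs_Seq runs_Minus) simp
    qed (use x fresh r in \<open>auto simp: add.commute\<close>)
    then show "runs (for_reg j (Seq (Minus a a 1) c)) (r'(i := x)) m'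
      (2 + n * (2 + (1 + T))) (?J (x * n))"
      by simp
  qed (use fresh r I in auto)
  then have "runs (for_cells i j a c) r m
      (1 + (2 + n * (2 + (2 + n * (2 + (1 + T)))))) (?J (0 * n))"
    unfolding for_cells_def using r by (intro runs_Seq runs_Plus) simp
  then show ?thesis by (rule runs_mono) (auto simp: algebra_simps)
qed

section \<open>The algorithm\<close>

definition matrix :: "nat \<Rightarrow> (nat \<Rightarrow> nat) \<Rightarrow> nat rel" where
  "matrix n m = {(x, y). x < n \<and> y < n \<and> m (x * n + y) \<noteq> 0}"

definition marked :: "nat \<Rightarrow> (nat \<Rightarrow> nat) \<Rightarrow> nat set" where
  "marked n m = {x. x < n \<and> m (n * n + x) \<noteq> 0}"

lemma cell_less:
  assumes "x < n" "y < (n::nat)"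
  shows "x * n + y < n * n"
proof -
  have "x * n + y < Suc x * n" using assms by simp
  also have "\<dots> \<le> n * n" using assms by (intro mult_le_mono1) simp
  finally show ?thesis .
qed

lemma cell_eq_iff:
  assumes "y < n" "y' < (n::nat)"
  shows "x * n + y = x' * n + y' \<longleftrightarrow> x = x' \<and> y = y'"
proof
  assume *: "x * n + y = x' * n + y'"
  have "(x * n + y) div n = x" "(x' * n + y') div n = x'" using assms by auto
  then show "x = x' \<and> y = y'" using * by auto
qed simp

lemma matrix_clear:
  assumes "x < n" "y < n"
  shows "matrix n (m(x * n + y := 0)) = matrix n m - {(x, y)}"
  using assms by (auto simp: matrix_def cell_eq_iff)

lemma matrix_set:
  assumes "x < n" "y < n" "k \<noteq> 0"
  shows "matrix n (m(x * n + y := k)) = insert (x, y) (matrix n m)"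
  using assms by (auto simp: matrix_def cell_eq_iff)

text \<open>Marks lie behind the matrix, so marking never changes an arc.\<close>

lemma matrix_update_mark: "matrix n (m(n * n + x := k)) = matrix n m"
proof -
  have "i * n + j \<noteq> n * n + x" if "i < n" "j < n" for i j
    using cell_less[OF that] by simp
  then show ?thesis by (auto simp: matrix_def)
qed

lemma marked_set: "x < n \<Longrightarrow> k \<noteq> 0 \<Longrightarrow> marked n (m(n * n + x := k)) = insert x (marked n m)"
  by (auto simp: marked_def)

text \<open>
  The arc \<open>(u, v)\<close> under examination sits in registers 4 and 5, its address in register 6. Vertex
  \<open>x\<close> is marked in cell \<open>n\<^sup>2 + x\<close>.
\<close>

definition clear_marks :: ram_prog where
  "clear_marks = for_reg 15 (Seq (Plus 14 3 15) (Store 14 2))"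

definition relax_all :: ram_prog where
  "relax_all = for_cells 10 11 12
     (Seq (Load 13 12) (If_Nonzero 13
       (Seq (Plus 14 3 10) (Seq (Load 13 14) (If_Nonzero 13
         (Seq (Plus 14 3 11) (Store 14 1)) Skip))) Skip))"

text \<open>
  The outer \<open>for_cells\<close> serves only as a loop with \<open>n\<^sup>2\<close> rounds, a bound on the number of arcs and
  hence on the length of a path.
\<close>

definition mark_reachable :: ram_prog where
  "mark_reachable = Seq clear_marks
     (Seq (Seq (Plus 14 3 4) (Store 14 1)) (for_cells 7 8 9 relax_all))"

text \<open>The arc is cleared before the search, so that a mark on its head witnesses a bypass;
  without one the arc is restored.\<close>

definition prune_arc :: ram_prog where
  "prune_arc = Seq (Load 13 6) (If_Nonzero 13
     (Seq (Store 6 2) (Seq mark_reachable (Seq (Plus 14 3 5) (Seq (Load 13 14)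
       (If_Nonzero 13 Skip (Store 6 1)))))) Skip)"

text \<open>The machine cannot multiply, so the square of \<open>n\<close> is built by
  \<open>n\<close> additions.\<close>

definition prune :: ram_prog where
  "prune = Seq (Set_Const 1 1) (Seq (for_reg 15 (Plus 3 3 0)) (for_cells 4 5 6 prune_arc))"

section \<open>Correctness and running time of the programs\<close>

lemma runs_clear_marks:
  assumes "r 0 = n" "r 1 = 1" "r 2 = 0" "r 3 = n * n"
  shows "runs clear_marks r m (2 + n * 4) (\<lambda>_ m'. matrix n m' = matrix n m \<and> marked n m' = {})"
proof -
  let ?I = "\<lambda>k (r' :: nat \<Rightarrow> nat) m'. matrix n m' = matrix n m \<and> (\<forall>x\<in>marked n m'. x < k)"
  have "runs clear_marks r m (2 + n * (2 + (1 + 1))) (?I 0)"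
    unfolding clear_marks_def
  proof (rule runs_for_reg[where I = ?I])
    fix k r' m'
    assume *: "k < n" "\<forall>q. q \<notin> insert 15 (writes (Seq (Plus 14 3 15) (Store 14 2))) \<longrightarrow> r' q = r q"
      "?I (Suc k) r' m'"
    then have "r' 3 = n * n" "r' 2 = 0" using assms by auto
    then show "runs (Seq (Plus 14 3 15) (Store 14 2)) (r'(15 := k)) m' (1 + 1) (?I k)"
      using *(3) by (intro runs_Seq runs_Plus runs_Store)
        (auto simp: matrix_update_mark marked_def less_Suc_eq split: if_splits)
  qed (use assms in \<open>auto simp: marked_def\<close>)
  then show ?thesis by (rule runs_mono) auto
qed

text \<open>Marks set during a sweep can be used by later cells of the same sweep, so the outcome is
  only enclosed between one step of \<open>E\<close> and full reachability.\<close>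

lemma runs_relax_all:
  fixes m :: "nat \<Rightarrow> nat"
  assumes "r 0 = n" "r 1 = 1" "r 2 = 0" "r 3 = n * n"
  defines "E \<equiv> matrix n m" and "S \<equiv> marked n m"
  shows "runs relax_all r m (3 + n * (4 + n * 12))
           (\<lambda>_ m'. matrix n m' = E \<and> S \<union> E `` S \<subseteq> marked n m' \<and> marked n m' \<subseteq> E\<^sup>* `` S)"
proof -
  \<comment> \<open>\<open>S\<close> stays the set of marks before the sweep; arcs leaving it at
    addresses from \<open>b\<close> on have been relaxed.\<close>
  define I where "I b m' \<longleftrightarrow> matrix n m' = E \<and> S \<subseteq> marked n m' \<and> marked n m' \<subseteq> E\<^sup>* `` S \<and>
      (\<forall>x y. (x, y) \<in> E \<longrightarrow> x \<in> S \<longrightarrow> b \<le> x * n + y \<longrightarrow> y \<in> marked n m')" for b m'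
  have "runs relax_all r m (3 + n * (4 + n * (3 +
      (1 + Suc ((1 + (1 + Suc ((1 + 1) + 1))) + 1))))) (\<lambda>_. I 0)"
    unfolding relax_all_def
  proof (rule runs_for_cells[where I = I])
    have "x * n + y < n * n" if "(x, y) \<in> E" for x y
      using that cell_less unfolding E_def matrix_def by auto
    then show "I (n * n) m"
      unfolding I_def by (fastforce simp: E_def S_def)
  next
    fix x y r' m'
    assume xy: "x < n" "y < n" "r' 10 = x" "r' 11 = y" "r' 12 = x * n + y"
      and I: "I (Suc (x * n + y)) m'"
      and "\<forall>q. q \<notin> {10, 11, 12} \<union> writes (Seq (Load 13 12) (If_Nonzero 13
        (Seq (Plus 14 3 10) (Seq (Load 13 14) (If_Nonzero 13
         (Seq (Plus 14 3 11) (Store 14 1)) Skip))) Skip)) \<longrightarrow> r' q = r q"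
    then have r': "r' 1 = 1" "r' 3 = n * n" using assms by auto
    have cell: "x' = x \<and> y' = y \<or> Suc (x * n + y) \<le> x' * n + y'"
      if "(x', y') \<in> E" "x * n + y \<le> x' * n + y'" for x' y'
      using that cell_eq_iff[of y n y' x x'] xy(2) unfolding E_def matrix_def
      by (auto simp: le_less)
    have skip: "I (x * n + y) m'" if "(x, y) \<in> E \<Longrightarrow> x \<in> S \<Longrightarrow> y \<in> marked n m'"
      using I that cell unfolding I_def by blast
    have mark: "I (x * n + y) (m'(n * n + y := 1))" if "(x, y) \<in> E" "x \<in> marked n m'"
    proof -
      have "y \<in> E\<^sup>* `` S" using I that unfolding I_def by (blast intro: rtrancl_into_rtrancl)
      moreover have "b \<in> insert y (marked n m')"
        if "(a, b) \<in> E" "a \<in> S" "x * n + y \<le> a * n + b" for a b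
        using cell[OF that(1,3)] that I unfolding I_def by blast
      ultimately show ?thesis
        using I xy(2) unfolding I_def by (auto simp: matrix_update_mark marked_set)
    qed
    have E: "(x, y) \<in> E \<longleftrightarrow> m' (x * n + y) \<noteq> 0"
      using I xy(1,2) unfolding I_def matrix_def by auto
    have S: "x \<in> marked n m' \<longleftrightarrow> m' (n * n + x) \<noteq> 0"
      using xy(1) by (simp add: marked_def)
    \<comment> \<open>A tail unmarked now was not in \<open>S\<close> either, so skipping its arc is
      sound.\<close>
    have "S \<subseteq> marked n m'" using I by (simp add: I_def)
    then show "runs (Seq (Load 13 12) (If_Nonzero 13
        (Seq (Plus 14 3 10) (Seq (Load 13 14) (If_Nonzero 13
         (Seq (Plus 14 3 11) (Store 14 1)) Skip))) Skip)) r' m'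
        (1 + Suc ((1 + (1 + Suc ((1 + 1) + 1))) + 1)) (\<lambda>_. I (x * n + y))"
      using E S xy r' skip mark
      by (intro runs_Seq runs_Plus runs_Store runs_Load runs_If_Nonzero runs_Skip) auto
  qed (use assms in auto)
  then show ?thesis by (rule runs_mono) (auto simp: I_def)
qed

lemma runs_mark_reachable:
  fixes m :: "nat \<Rightarrow> nat"
  assumes "r 0 = n" "r 1 = 1" "r 2 = 0" "r 3 = n * n" "r 4 = u" "u < n"
  defines "E \<equiv> matrix n m"
  shows "runs mark_reachable r m (7 + n * 4 + n * (4 + n * (6 + n * (4 + n * 12))))
           (\<lambda>_ m'. matrix n m' = E \<and> marked n m' = E\<^sup>* `` {u})"
proof -
  \<comment> \<open>With the index at \<open>b\<close>, \<open>n * n - b\<close> rounds are over,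
    and every walk from \<open>u\<close> of at most that length ends in a marked vertex.\<close>
  define I where "I b m' \<longleftrightarrow> matrix n m' = E \<and> marked n m' \<subseteq> E\<^sup>* `` {u} \<and>
      (\<forall>k \<le> n * n - b. (E ^^ k) `` {u} \<subseteq> marked n m')" for b m'
  have E_sub: "E \<subseteq> {..<n} \<times> {..<n}" by (auto simp: E_def matrix_def)
  have loop: "runs (for_cells 7 8 9 relax_all) r' m'
      (3 + n * (4 + n * (3 + (3 + n * (4 + n * 12))))) (\<lambda>_. I 0)"
    if "r' 0 = n" "r' 1 = 1" "r' 2 = 0" "r' 3 = n * n" "I (n * n) m'" for r' m'
  proof (rule runs_for_cells[where I = I])
    fix x y r'' m''
    assume xy: "x < n" "y < n" and I: "I (Suc (x * n + y)) m''"
      and r'': "\<forall>q. q \<notin> {7, 8, 9} \<union> writes relax_all \<longrightarrow> r'' q = r' q"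
    have less: "x * n + y < n * n" using cell_less xy by blast
    have "runs relax_all r'' m'' (3 + n * (4 + n * 12))
           (\<lambda>_ m'. matrix n m' = matrix n m'' \<and>
              marked n m'' \<union> matrix n m'' `` marked n m'' \<subseteq> marked n m' \<and>
              marked n m' \<subseteq> (matrix n m'')\<^sup>* `` marked n m'')"
      by (rule runs_relax_all) (use that r'' in \<open>auto simp: relax_all_def\<close>)
    then show "runs relax_all r'' m'' (3 + n * (4 + n * 12)) (\<lambda>_. I (x * n + y))"
    proof (rule runs_mono)
      fix m3
      assume m3: "matrix n m3 = matrix n m'' \<and>
              marked n m'' \<union> matrix n m'' `` marked n m'' \<subseteq> marked n m3 \<and>
              marked n m3 \<subseteq> (matrix n m'')\<^sup>* `` marked n m''"
      have E: "matrix n m'' = E" using I by (simp add: I_def)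
      have "(E ^^ k) `` {u} \<subseteq> marked n m3" if k: "k \<le> n * n - (x * n + y)" for k
      proof (cases "k \<le> n * n - Suc (x * n + y)")
        case True
        with I m3 show ?thesis unfolding I_def by blast
      next
        case False
        \<comment> \<open>The one new length: the last arc of such a walk is supplied by the current
          sweep.\<close>
        with k less have k': "k = Suc (n * n - Suc (x * n + y))" by simp
        have "(E ^^ (n * n - Suc (x * n + y))) `` {u} \<subseteq> marked n m''"
          using I unfolding I_def by blast
        then show ?thesis using m3 unfolding E k' by auto
      qed
      moreover have "marked n m3 \<subseteq> E\<^sup>* `` {u}"
      proof -
        have "marked n m3 \<subseteq> E\<^sup>* `` (E\<^sup>* `` {u})" using I m3 unfolding I_def by blast
        also have "\<dots> \<subseteq> E\<^sup>* `` {u}" by (auto intro: rtrancl_trans)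
        finally show ?thesis .
      qed
      ultimately show "I (x * n + y) m3" using m3 E by (simp add: I_def)
    qed simp
  qed (use that in \<open>auto simp: relax_all_def\<close>)
  have "runs mark_reachable r m
      ((2 + n * 4) + ((1 + 1) + (3 + n * (4 + n * (3 + (3 + n * (4 + n * 12))))))) (\<lambda>_. I 0)"
    unfolding mark_reachable_def
    apply (rule runs_Seq)
    apply (rule runs_mono[OF runs_clear_marks order_refl])
    subgoal by (rule assms)
    subgoal by (rule assms)
    subgoal by (rule assms)
    subgoal by (rule assms)
    subgoal for r' m'
      apply (intro runs_Seq runs_Plus runs_Store loop)
      using assms by (auto simp: clear_marks_def I_def matrix_update_mark marked_set)
    done
  then show ?thesis
  proof (rule runs_mono)
    fix m'
    assume I: "I 0 m'"
    have "E\<^sup>* `` {u} \<subseteq> marked n m'"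
    proof
      fix v assume "v \<in> E\<^sup>* `` {u}"
      moreover have "finite E" using E_sub by (rule finite_subset) simp
      ultimately obtain k where k: "k \<le> card E" "(u, v) \<in> E ^^ k"
        by (auto simp: rtrancl_finite_eq_relpow)
      have "card E \<le> n * n" using card_mono[OF _ E_sub] by simp
      with k(1) have "k \<le> n * n" by simp
      with k(2) I show "v \<in> marked n m'" unfolding I_def by auto
    qed
    with I show "matrix n m' = E \<and> marked n m' = E\<^sup>* `` {u}" by (auto simp: I_def)
  qed simp
qed

lemma runs_prune_arc:
  fixes m :: "nat \<Rightarrow> nat"
  assumes "r 0 = n" "r 1 = 1" "r 2 = 0" "r 3 = n * n"
    and "r 4 = u" "r 5 = v" "r 6 = u * n + v" "u < n" "v < n"
  defines "E \<equiv> matrix n m"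
  shows "runs prune_arc r m (16 + n * 4 + n * (4 + n * (6 + n * (4 + n * 12))))
           (\<lambda>_ m'. matrix n m' =
              (if (u, v) \<in> (E - {(u, v)})\<^sup>* then E - {(u, v)} else E))"
proof -
  let ?Q = "\<lambda>_ :: nat \<Rightarrow> nat. \<lambda>m'. matrix n m' =
    (if (u, v) \<in> (E - {(u, v)})\<^sup>* then E - {(u, v)} else E)"
  let ?T = "7 + n * 4 + n * (4 + n * (6 + n * (4 + n * 12)))"
  have E: "(u, v) \<in> E \<longleftrightarrow> m (u * n + v) \<noteq> 0"
    using assms by (auto simp: matrix_def)
  have arc: "runs (Seq mark_reachable (Seq (Plus 14 3 5) (Seq (Load 13 14)
      (If_Nonzero 13 Skip (Store 6 1))))) r' m' (?T + (1 + (1 + Suc (1 + 1)))) ?Q"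
    if "m (u * n + v) \<noteq> 0" "r' = r(13 := m (r 6))" "m' = m(u * n + v := 0)" for r' m'
  proof (rule runs_Seq)
    have m': "matrix n m' = E - {(u, v)}"
      using that assms by (simp add: matrix_clear)
    have "runs mark_reachable r' m' ?T
        (\<lambda>_ m'a. matrix n m'a = matrix n m' \<and> marked n m'a = (matrix n m')\<^sup>* `` {u})"
      by (rule runs_mark_reachable) (use that assms in auto)
    then show "runs mark_reachable r' m' ?T (\<lambda>r' m'. runs (Seq (Plus 14 3 5) (Seq (Load 13 14)
      (If_Nonzero 13 Skip (Store 6 1)))) r' m' (1 + (1 + Suc (1 + 1))) ?Q)"
    proof (rule runs_mono)
      fix r'' m''
      assume "matrix n m'' = matrix n m' \<and> marked n m'' = (matrix n m')\<^sup>* `` {u}"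
        and "\<forall>q. q \<notin> writes mark_reachable \<longrightarrow> r'' q = r' q"
      then have m'': "matrix n m'' = E - {(u, v)}"
          "v \<in> marked n m'' \<longleftrightarrow> (u, v) \<in> (E - {(u, v)})\<^sup>*"
        and r'': "r'' 1 = 1" "r'' 3 = n * n" "r'' 5 = v" "r'' 6 = u * n + v"
        using that assms m' by (auto simp: mark_reachable_def clear_marks_def relax_all_def)
      have "m'' (n * n + v) \<noteq> 0 \<longleftrightarrow> (u, v) \<in> (E - {(u, v)})\<^sup>*"
        using m''(2) \<open>v < n\<close> by (simp add: marked_def)
      \<comment> \<open>Only being nonzero matters, so storing 1 restores the arc whatever its old
        entry was.\<close>
      moreover have "matrix n (m''(u * n + v := 1)) = E"
        using m''(1) E that(1) assms(8,9) by (auto simp: matrix_set)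
      ultimately show "runs (Seq (Plus 14 3 5) (Seq (Load 13 14)
          (If_Nonzero 13 Skip (Store 6 1)))) r'' m'' (1 + (1 + Suc (1 + 1))) ?Q"
        using r'' m''(1)
        by (intro runs_Seq runs_Plus runs_Load runs_If_Nonzero runs_Skip runs_Store) auto
    qed simp
  qed
  have "runs prune_arc r m (1 + Suc ((1 + (?T + (1 + (1 + Suc (1 + 1))))) + 1)) ?Q"
    unfolding prune_arc_def
    apply (rule runs_Seq, rule runs_Load, rule runs_If_Nonzero)
    subgoal
      using assms(1-7) by (intro runs_Seq[OF runs_Store] arc) auto
    \<comment> \<open>Without the arc, \<open>E - {(u, v)}\<close> equals \<open>E\<close>, so both
      alternatives of the postcondition agree.\<close>
    subgoal
      using assms(1-7) E by (intro runs_Skip) (auto simp: E_def)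
    done
  then show ?thesis by (rule runs_mono) auto
qed

text \<open>One sweep suffices: an arc found indispensable remains so, because later deletions only
  remove possible bypasses.\<close>

lemma runs_prune:
  fixes m :: "nat \<Rightarrow> nat"
  assumes "strong_on {..<n} (matrix n m)"
  shows "runs prune ((\<lambda>_. 0)(0 := n)) m
           (6 + n * 3 + n * (4 + n * (19 + n * 4 + n * (4 + n * (6 + n * (4 + n * 12))))))
           (\<lambda>r' m'. r' 0 = n \<and> matrix n m' \<subseteq> matrix n m \<and>
              minimally_strong_on {..<n} (matrix n m'))"
proof -
  define I where "I b m' \<longleftrightarrow> matrix n m' \<subseteq> matrix n m \<and> strong_on {..<n} (matrix n m') \<and>
      (\<forall>x y. (x, y) \<in> matrix n m' \<longrightarrow> b \<le> x * n + y \<longrightarrow>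
        (x, y) \<notin> (matrix n m' - {(x, y)})\<^sup>*)" for b m'
  let ?r = "(\<lambda>_. 0)(0 := n, Suc 0 := Suc 0)"
  let ?T = "16 + n * 4 + n * (4 + n * (6 + n * (4 + n * 12)))"
  have square: "runs (for_reg 15 (Plus 3 3 0)) ?r m (2 + n * (2 + 1))
      (\<lambda>r' m'. r' 3 = (n - 0) * n \<and> m' = m)"
  proof (rule runs_for_reg[where I = "\<lambda>k r' m'. r' 3 = (n - k) * n \<and> m' = m"])
    fix k r' m'
    assume *: "k < n" "\<forall>q. q \<notin> insert 15 (writes (Plus 3 3 0)) \<longrightarrow> r' q = ?r q"
      "r' 3 = (n - Suc k) * n \<and> m' = m"
    have "n - k = Suc (n - Suc k)" using *(1) by simp
    then show "runs (Plus 3 3 0) (r'(15 := k)) m' 1 (\<lambda>r' m'. r' 3 = (n - k) * n \<and> m' = m)"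
      using * by (intro runs_Plus) auto
  qed auto
  have main: "runs (for_cells 4 5 6 prune_arc) r m (3 + n * (4 + n * (3 + ?T))) (\<lambda>_. I 0)"
    if r: "r 0 = n" "r 1 = 1" "r 2 = 0" "r 3 = n * n" for r
  proof (rule runs_for_cells[where I = I])
    \<comment> \<open>Minimality is vacuous at the start, as every cell has an address below
      \<open>n * n\<close>.\<close>
    show "I (n * n) m"
      using assms cell_less unfolding I_def matrix_def by (fastforce simp: not_le)
  next
    fix u v r' m'
    assume uv: "u < n" "v < n" "r' 4 = u" "r' 5 = v" "r' 6 = u * n + v"
      and r': "\<forall>q. q \<notin> {4, 5, 6} \<union> writes prune_arc \<longrightarrow> r' q = r q"
      and I: "I (Suc (u * n + v)) m'"
    let ?E = "matrix n m'"
    have "runs prune_arc r' m' ?T (\<lambda>_ m'. matrix n m' =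
        (if (u, v) \<in> (?E - {(u, v)})\<^sup>* then ?E - {(u, v)} else ?E))"
      by (rule runs_prune_arc)
        (use uv r r' in \<open>auto simp: prune_arc_def mark_reachable_def clear_marks_def relax_all_def\<close>)
    then show "runs prune_arc r' m' ?T (\<lambda>_. I (u * n + v))"
    proof (rule runs_mono)
      fix m''
      assume m'': "matrix n m'' = (if (u, v) \<in> (?E - {(u, v)})\<^sup>* then ?E - {(u, v)} else ?E)"
      have later: "(x, y) \<noteq> (u, v) \<Longrightarrow> u * n + v \<le> x * n + y \<Longrightarrow> (x, y) \<in> ?E \<Longrightarrow>
          (x, y) \<notin> (?E - {(x, y)})\<^sup>*" for x y
      proof -
        assume *: "(x, y) \<noteq> (u, v)" "u * n + v \<le> x * n + y" "(x, y) \<in> ?E"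
        then have "y < n" by (simp add: matrix_def)
        then have "Suc (u * n + v) \<le> x * n + y"
          using * cell_eq_iff[of v n y u x] uv(2) by (auto simp: le_less)
        with * I show "(x, y) \<notin> (?E - {(x, y)})\<^sup>*" unfolding I_def by blast
      qed
      show "I (u * n + v) m''"
      proof (cases "(u, v) \<in> (?E - {(u, v)})\<^sup>*")
        case True
        then have E: "matrix n m'' = ?E - {(u, v)}" using m'' by simp
        \<comment> \<open>The bypass replaces \<open>(u, v)\<close> in every walk, so no
          reachability is lost.\<close>
        have "?E \<subseteq> (?E - {(u, v)})\<^sup>*" using True by auto
        then have "?E\<^sup>* \<subseteq> (?E - {(u, v)})\<^sup>*" by (rule rtrancl_subset_rtrancl)
        then have "strong_on {..<n} (matrix n m'')"
          using I unfolding E I_def strong_on_def by blast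
        moreover have "(x, y) \<notin> (matrix n m'' - {(x, y)})\<^sup>*"
          if "(x, y) \<in> matrix n m''" "u * n + v \<le> x * n + y" for x y
        proof -
          have "(x, y) \<notin> (?E - {(x, y)})\<^sup>*" using later that E by auto
          moreover have "(matrix n m'' - {(x, y)})\<^sup>* \<subseteq> (?E - {(x, y)})\<^sup>*"
            unfolding E by (rule rtrancl_mono) auto
          ultimately show ?thesis by blast
        qed
        moreover have "matrix n m'' \<subseteq> matrix n m" using I unfolding E I_def by auto
        ultimately show ?thesis by (auto simp: I_def)
      next
        case False
        then have "matrix n m'' = ?E" using m'' by simp
        moreover have "(x, y) \<notin> (?E - {(x, y)})\<^sup>*"
          if "(x, y) \<in> ?E" "u * n + v \<le> x * n + y" for x y
          using False later that by (cases "(x, y) = (u, v)") auto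
        ultimately show ?thesis using I unfolding I_def by simp
      qed
    qed simp
  qed (use r in \<open>auto simp: prune_arc_def mark_reachable_def clear_marks_def relax_all_def\<close>)
  have "runs prune ((\<lambda>_. 0)(0 := n)) m
      (1 + ((2 + n * (2 + 1)) + (3 + n * (4 + n * (3 + ?T))))) (\<lambda>_. I 0)"
    unfolding prune_def
    apply (rule runs_Seq, rule runs_Set_Const, rule runs_Seq)
    apply simp
    apply (rule runs_mono[OF square])
     apply simp
    subgoal for r' m'
      using main[of r'] by simp
    done
  then show ?thesis
    by (rule runs_mono)
      (auto simp: I_def minimally_strong_on_def prune_def prune_arc_def mark_reachable_def
        clear_marks_def relax_all_def)
qed

section \<open>From matrices back to digraphs\<close>

lemma pair_wf_digraph_strongly_connected_iff:
  "pair_wf_digraph D \<Longrightarrow> strongly_connected (with_proj D) \<longleftrightarrow>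
     pverts D \<noteq> {} \<and> strong_on (pverts D) (parcs D)"
  using wf_digraph.strongly_connected_iff_strong_on[of "with_proj D"]
  by (simp add: wf_digraph_wp_iff)

lemma polytime_spanning_strong_3_partite:
  "polytime_constructible
     (\<lambda>D. strongly_connected (with_proj D))
     (\<lambda>D H. spanning (with_proj H) (with_proj D) \<and>
            strongly_connected (with_proj H) \<and> k_partite 3 (with_proj H))"
proof -
  \<comment> \<open>The bound of \<open>runs_prune\<close> with the indeterminate in place of
    \<open>n\<close>.\<close>
  define p :: "nat poly" where
    "p = (let X = [:0, 1:] in
       6 + X * 3 + X * (4 + X * (19 + X * 4 + X * (4 + X * (6 + X * (4 + X * 12))))))"
  have p: "poly p n = 6 + n * 3 +
      n * (4 + n * (19 + n * 4 + n * (4 + n * (6 + n * (4 + n * 12)))))" for n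
    by (simp add: p_def Let_def)
  have "\<exists>t s. ram_exec prune (input_state D) t s \<and> t \<le> poly p n \<and>
      spanning (with_proj (output_digraph s)) (with_proj D) \<and>
      strongly_connected (with_proj (output_digraph s)) \<and>
      k_partite 3 (with_proj (output_digraph s))"
    if D: "pair_digraph D" "pverts D = {..<n}" "strongly_connected (with_proj D)" for n D
  proof -
    interpret D: pair_digraph D by (rule D)
    have D_sub: "parcs D \<subseteq> {..<n} \<times> {..<n}"
      using D.arc_fst_in_verts D.arc_snd_in_verts D(2) by fastforce
    define m where "m = snd (input_state D)"
    have input: "input_state D = ((\<lambda>_. 0)(0 := n), m)"
      unfolding m_def input_state_def Let_def D(2) by simp
    have m: "matrix n m = parcs D"
      using D_sub cell_less unfolding matrix_def m_def input_state_def Let_def D(2) by auto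
    have "strong_on {..<n} (matrix n m)" "n > 0"
      using D m pair_wf_digraph_strongly_connected_iff[OF D.pair_wf_digraph_axioms] by auto
    with runs_prune[of n m] obtain t r' m' where
      t: "ram_exec prune (input_state D) t (r', m')" "t \<le> poly p n" "r' 0 = n"
        "matrix n m' \<subseteq> parcs D" "minimally_strong_on {..<n} (matrix n m')"
      unfolding runs_def p m input by blast
    define H where "H = \<lparr>pverts = {..<n}, parcs = matrix n m'\<rparr>"
    have H: "output_digraph (r', m') = H"
      using t(3) by (simp add: output_digraph_def H_def matrix_def Let_def)
    have H_sub: "matrix n m' \<subseteq> {..<n} \<times> {..<n}" by (auto simp: matrix_def)
    interpret H: pair_wf_digraph H by unfold_locales (use H_sub in \<open>auto simp: H_def\<close>)
    have "strongly_connected (with_proj H)"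
      using t(5) \<open>n > 0\<close> unfolding pair_wf_digraph_strongly_connected_iff[OF H.pair_wf_digraph_axioms]
      by (auto simp: H_def minimally_strong_on_def)
    moreover have "spanning (with_proj H) (with_proj D)"
      using t(4) D(2) D.wf_digraph H.wf_digraph
      by (auto simp: spanning_def subgraph_def compatible_def H_def)
    moreover have "k_partite 3 (with_proj H)"
      unfolding H_def using t(5) H_sub by (intro minimally_strong_3_partite) auto
    ultimately show ?thesis using t(1,2) H by metis
  qed
  then show ?thesis
    unfolding polytime_constructible_def by blast
qed

theorem proposition5p1:
  shows "(\<forall>D :: ('a, 'b) pre_digraph. digraph D \<and> strongly_connected D \<longrightarrow>
            (\<exists>H. spanning H D \<and> strongly_connected H \<and> k_partite 3 H)) \<and>
         polytime_constructible
           (\<lambda>D. strongly_connected (with_proj D))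
           (\<lambda>D H. spanning (with_proj H) (with_proj D) \<and>
                  strongly_connected (with_proj H) \<and> k_partite 3 (with_proj H))"
  using digraph.spanning_strong_3_partite polytime_spanning_strong_3_partite by blast

end
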